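(* Let $n \geq 2$ and $S=S_1 \times S_2 \times \cdots \times S_n$, where $S_i=\mathcal{B}$ is the Boolean semiring for every $i=1,2,\ldots,n$. Then $\dim(\Gamma_1(S))=n$ if $n \neq 2$, and $\dim(\Gamma_1(S))=n-1$ if $n = 2$.
   Context: A semiring is a set $S$ with binary operations $+$ and $\cdot$ such that $(S,+)$ is a commutative monoid with identity $0$, $(S,\cdot)$ is a monoid with identity $1$, multiplication distributes over addition on both sides, and $0\cdot x = x\cdot 0 = 0$ for all $x\in S$. The Boolean semiring is $\mathcal{B}=\{0,1\}$ with $0\neq 1$ and $1+1=1$. Direct products of semirings have componentwise operations. The set of zero-divisors of $S$ is $Z(S)=\{x \in S : \text{there exists } 0 \neq y \in S \text{ such that } xy=0 \text{ or } yx=0\}$ (so $0\in Z(S)$ when $S\neq\{0\}$). $\Gamma_1(S)$ is the simple undirected graph with vertex set $Z(S)$ in which distinct $x,y\in Z(S)$ are adjacent if and only if $x+y\in Z(S)$ (it is the subgraph, induced on $Z(S)$, of the total graph of $S$). For a finite connected graph $G$, $d(u,v)$ denotes the length of a shortest path between $u$ and $v$. For an ordered subset $W=\{w_1,\ldots,w_k\}$ of the vertex set, the representation of a vertex $v$ with respect to $W$ is the vector $(d(v,w_1),\ldots,d(v,w_k))$. $W$ is a resolving set for $G$ if distinct vertices of $G$ have distinct representations with respect to $W$. The metric dimension $\dim(G)$ is the minimal cardinality of a resolving set for $G$. *)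

theory Defs
  imports
    "HOL-Analysis.Finite_Cartesian_Product"
    "Graph_Theory.Pair_Digraph"
    "Graph_Theory.Vertex_Walk"
begin

datatype boolean = BZero | BOne

instantiation boolean :: comm_semiring_1
begin

definition zero_boolean :: boolean where "0 = BZero"
definition one_boolean :: boolean where "1 = BOne"

fun plus_boolean :: "boolean \<Rightarrow> boolean \<Rightarrow> boolean" where
  "BZero + y = y"
| "BOne + y = BOne"

fun times_boolean :: "boolean \<Rightarrow> boolean \<Rightarrow> boolean" where
  "BZero * y = BZero"
| "BOne * y = y"

instance
proof
  fix a b c :: boolean
  show "a + b + c = a + (b + c)" by (cases a) simp_all
  show "a + b = b + a" by (cases a; cases b) simp_all
  show "0 + a = a" by (simp add: zero_boolean_def)
  show "a * b * c = a * (b * c)" by (cases a) simp_all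
  show "a * b = b * a" by (cases a; cases b) simp_all
  show "1 * a = a" by (simp add: one_boolean_def)
  show "(a + b) * c = a * c + b * c" by (cases a; cases b; cases c) simp_all
  show "0 * a = 0" by (simp add: zero_boolean_def)
  show "a * 0 = 0" by (cases a) (simp_all add: zero_boolean_def)
  show "(0::boolean) \<noteq> 1" by (simp add: zero_boolean_def one_boolean_def)
qed

end

lemma boolean_one_plus_one: "(1::boolean) + 1 = 1"
  by (simp add: one_boolean_def)

lemma UNIV_boolean: "(UNIV :: boolean set) = {0, 1}"
  using boolean.exhaust by (auto simp: zero_boolean_def one_boolean_def)

instance boolean :: finite
  by standard (simp add: UNIV_boolean)

text \<open>
  The sort \<open>{semiring_0, monoid_mult}\<close> is that of unital semirings; unlike \<open>semiring_1\<close>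
  it does not require \<open>0 \<noteq> 1\<close>.
\<close>

definition zero_divisors :: "'a :: {semiring_0, monoid_mult} set" where
  "zero_divisors = {x. \<exists>y. y \<noteq> 0 \<and> (x * y = 0 \<or> y * x = 0)}"

text \<open>A simple undirected graph is represented as a loop-free symmetric digraph.\<close>

definition Gamma1 :: "'a :: {semiring_0, monoid_mult} pair_pre_digraph" where
  "Gamma1 =
    \<lparr> pverts = zero_divisors,
      parcs = {(x, y). x \<in> zero_divisors \<and> y \<in> zero_divisors \<and> x \<noteq> y \<and> x + y \<in> zero_divisors} \<rparr>"

lemma pair_graph_Gamma1:
  "pair_graph (Gamma1 :: 'a :: {semiring_0, monoid_mult, finite} pair_pre_digraph)"
  by unfold_locales
    (auto simp: Gamma1_def symmetric_def sym_def add.commute)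

text \<open>
  Only meaningful if there is a path from \<open>u\<close> to \<open>v\<close>, in particular if \<open>G\<close> is connected.
  A path is given by its list of vertices, and \<open>vwalk_length\<close> counts edges.
\<close>

definition graph_dist :: "('a, 'b) pre_digraph \<Rightarrow> 'a \<Rightarrow> 'a \<Rightarrow> nat" where
  "graph_dist G u v = (LEAST k. \<exists>p. vpath p G \<and> hd p = u \<and> last p = v \<and> vwalk_length p = k)"

text \<open>Any two vertices of \<open>Gamma1\<close> are joined by a path, through \<open>0\<close> if need be.\<close>

lemma Gamma1_path_exists:
  fixes u v :: "'a :: {semiring_0, monoid_mult}"
  assumes "u \<in> pverts Gamma1" "v \<in> pverts Gamma1"
  shows "\<exists>p. vpath p (with_proj Gamma1) \<and> hd p = u \<and> last p = v"
proof -
  have 0: "(0 :: 'a) \<in> zero_divisors" if "x \<in> zero_divisors" for x :: 'a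
    using that by (auto simp: zero_divisors_def)
  consider "u = v" | "u \<noteq> v" "u = 0 \<or> v = 0" | "u \<noteq> v" "u \<noteq> 0" "v \<noteq> 0" by blast
  then show ?thesis
  proof cases
    case 1
    then show ?thesis using assms by (intro exI[of _ "[u]"]) (auto simp: vpath_def vwalk_def)
  next
    case 2
    then show ?thesis using assms
      by (intro exI[of _ "[u, v]"]) (auto simp: vpath_def vwalk_def Gamma1_def)
  next
    case 3
    then show ?thesis using assms 0
      by (intro exI[of _ "[u, 0, v]"]) (auto simp: vpath_def vwalk_def Gamma1_def)
  qed
qed

definition representation :: "('a, 'b) pre_digraph \<Rightarrow> 'a list \<Rightarrow> 'a \<Rightarrow> nat list" where
  "representation G ws v = map (graph_dist G v) ws"

text \<open>An ordered subset of the vertex set is a list of pairwise distinct vertices.\<close>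

definition resolving_set :: "('a, 'b) pre_digraph \<Rightarrow> 'a list \<Rightarrow> bool" where
  "resolving_set G ws \<longleftrightarrow>
    distinct ws \<and> set ws \<subseteq> verts G \<and>
    (\<forall>u \<in> verts G. \<forall>v \<in> verts G. u \<noteq> v \<longrightarrow> representation G ws u \<noteq> representation G ws v)"

definition metric_dim :: "('a, 'b) pre_digraph \<Rightarrow> nat" where
  "metric_dim G = (LEAST k. \<exists>ws. resolving_set G ws \<and> length ws = k)"

end

theory Submission
  imports Defs
begin

text \<open>
  Since \<open>0\<close> is adjacent to every other vertex of \<open>Gamma1\<close>, distances are at most \<open>2\<close>.  A list of
  \<open>k\<close> landmarks therefore represents all vertices other than the landmarks by words of length \<open>k\<close>
  over \<open>{1, 2}\<close>, so a resolving list of length \<open>k\<close> forces the graph to have at most \<open>k + 2 ^ k\<close>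
  vertices (\<open>card_verts_le_if_resolving\<close>).

  A vector over the Boolean semiring is a zero-divisor unless all its entries are \<open>1\<close>, so for
  \<open>S = \<B>\<^sup>n\<close> there are \<open>2 ^ n - 1\<close> vertices.  For \<open>n \<ge> 3\<close> the bound is violated by every \<open>k < n\<close>,
  and for \<open>n = 2\<close> only by \<open>k = 0\<close>.

  Conversely, adding a vector \<open>x\<close> to the vector whose only zero entry is at \<open>i\<close> gives the all-ones
  vector exactly if \<open>x\<close> is \<open>1\<close> at \<open>i\<close>.  The distance from \<open>x\<close> to that coatom therefore reveals the
  entry of \<open>x\<close> at \<open>i\<close> (\<open>graph_dist_coatom\<close>), and the \<open>n\<close> coatoms together determine \<open>x\<close>.  For
  \<open>n = 2\<close> the graph is a path with centre \<open>0\<close> and an end vertex alone resolves it.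
\<close>

section \<open>Distances in the graph of zero-divisors\<close>

lemma pverts_Gamma1 [simp]: "pverts Gamma1 = zero_divisors"
  by (simp add: Gamma1_def)

lemma graph_dist_eqI:
  assumes "vpath p G" "hd p = u" "last p = v" "vwalk_length p = k"
    and "\<And>q. vpath q G \<Longrightarrow> hd q = u \<Longrightarrow> last q = v \<Longrightarrow> k \<le> vwalk_length q"
  shows "graph_dist G u v = k"
  unfolding graph_dist_def using assms by (intro Least_equality) blast+

text \<open>The detour through \<open>0\<close> joins any two vertices that are not adjacent.\<close>

lemma graph_dist_Gamma1:
  fixes u v :: "'a :: {semiring_0, monoid_mult}"
  assumes u: "u \<in> zero_divisors" and v: "v \<in> zero_divisors"
  shows "graph_dist (with_proj Gamma1) u v =
    (if u = v then 0 else if u + v \<in> zero_divisors then 1 else 2)"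
proof -
  let ?G = "with_proj (Gamma1 :: 'a pair_pre_digraph)"
  have 0: "(0 :: 'a) \<in> zero_divisors"
    using u by (auto simp: zero_divisors_def)
  have ge1: "1 \<le> vwalk_length q" if "u \<noteq> v" "vpath q ?G" "hd q = u" "last q = v" for q
  proof -
    consider "q = []" | x where "q = [x]" | x y zs where "q = x # y # zs"
      by (metis list.exhaust)
    then show ?thesis
      using that by cases (auto simp: vpath_def vwalk_def)
  qed
  have ge2: "2 \<le> vwalk_length q"
    if "u \<noteq> v" "u + v \<notin> zero_divisors" "vpath q ?G" "hd q = u" "last q = v" for q
  proof -
    consider "q = []" | x where "q = [x]" | x y where "q = [x, y]" | x y z zs where "q = x # y # z # zs"
      by (metis list.exhaust)
    then show ?thesis
      using that by cases (auto simp: vpath_def vwalk_def Gamma1_def)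
  qed
  consider "u = v" | "u \<noteq> v" "u + v \<in> zero_divisors" | "u \<noteq> v" "u + v \<notin> zero_divisors"
    by blast
  then show ?thesis
  proof cases
    case 1
    have "graph_dist ?G u v = 0"
      using 1 u by (intro graph_dist_eqI[of "[u]"]) (auto simp: vpath_def vwalk_def Gamma1_def)
    with 1 show ?thesis by simp
  next
    case 2
    have "graph_dist ?G u v = 1"
      using 2 u v ge1
      by (intro graph_dist_eqI[of "[u, v]"]) (auto simp: vpath_def vwalk_def Gamma1_def)
    with 2 show ?thesis by simp
  next
    case 3
    have "u \<noteq> 0" "v \<noteq> 0"
      using 3 u v by auto
    then have "graph_dist ?G u v = 2"
      using 3 u v 0 ge2
      by (intro graph_dist_eqI[of "[u, 0, v]"]) (auto simp: vpath_def vwalk_def Gamma1_def)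
    with 3 show ?thesis by simp
  qed
qed

section \<open>A counting bound for resolving sets\<close>

text \<open>
  The landmarks are counted separately because only they have a \<open>0\<close> in their representation.
\<close>

lemma card_verts_le_if_resolving:
  assumes res: "resolving_set G ws" and fin: "finite (verts G)"
    and dist: "\<And>v w. v \<in> verts G \<Longrightarrow> w \<in> verts G \<Longrightarrow> v \<noteq> w \<Longrightarrow> graph_dist G v w \<in> {1, 2}"
  shows "card (verts G) \<le> length ws + 2 ^ length ws"
proof -
  let ?words = "{xs. set xs \<subseteq> {1, 2 :: nat} \<and> length xs = length ws}"
  have ws: "distinct ws" "set ws \<subseteq> verts G"
    using res by (auto simp: resolving_set_def)
  have "inj_on (representation G ws) (verts G - set ws)"
    using res by (auto simp: resolving_set_def intro!: inj_onI)
  moreover have "representation G ws ` (verts G - set ws) \<subseteq> ?words"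
    using dist ws(2) by (fastforce simp: representation_def)
  ultimately have "card (verts G - set ws) \<le> card ?words"
    by (intro card_inj_on_le finite_lists_length_eq) auto
  also have "\<dots> = 2 ^ length ws"
    using card_lists_length_eq[of "{1, 2 :: nat}" "length ws"] by (simp add: numeral_2_eq_2)
  finally have "card (verts G - set ws) \<le> 2 ^ length ws" .
  moreover have "card (verts G - set ws) = card (verts G) - length ws"
    using ws by (simp add: card_Diff_subset distinct_card)
  ultimately show ?thesis by simp
qed

lemma metric_dim_eqI:
  assumes "resolving_set G ws" "length ws = k"
    and "\<And>ws. resolving_set G ws \<Longrightarrow> k \<le> length ws"
  shows "metric_dim G = k"
  unfolding metric_dim_def using assms by (intro Least_equality) auto

section \<open>Powers of the Boolean semiring\<close>

lemma boolean_neq_0_iff: "(x :: boolean) \<noteq> 0 \<longleftrightarrow> x = 1"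
  by (cases x) (simp_all add: zero_boolean_def one_boolean_def)

lemma boolean_add_eq_1_iff: "(x :: boolean) + y = 1 \<longleftrightarrow> x = 1 \<or> y = 1"
  by (cases x) (simp_all add: one_boolean_def)

text \<open>If \<open>x\<close> vanishes at \<open>i\<close>, it is annihilated by the unit vector at \<open>i\<close>.\<close>

lemma zero_divisors_boolean_vec: "zero_divisors = - {1 :: boolean ^ 'n::finite}"
proof (intro set_eqI iffI)
  fix x :: "boolean ^ 'n"
  assume "x \<in> - {1}"
  then obtain i where "x $ i \<noteq> 1"
    by (auto simp: vec_eq_iff)
  then have i: "x $ i = 0"
    using boolean_neq_0_iff by blast
  let ?e = "(\<chi> j. if j = i then 1 else 0) :: boolean ^ 'n"
  have "?e \<noteq> 0" "x * ?e = 0"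
    using i by (auto simp: vec_eq_iff)
  then show "x \<in> zero_divisors"
    unfolding zero_divisors_def by blast
qed (auto simp: zero_divisors_def)

lemma card_zero_divisors_boolean_vec:
  "card (zero_divisors :: (boolean ^ 'n::finite) set) = 2 ^ CARD('n) - 1"
proof -
  have "CARD(boolean) = 2"
    by (simp add: UNIV_boolean)
  then show ?thesis
    by (simp add: zero_divisors_boolean_vec Compl_eq_Diff_UNIV card_Diff_subset)
qed

definition coatom :: "'n \<Rightarrow> boolean ^ 'n::finite" where
  "coatom i = (\<chi> j. if j = i then 0 else 1)"

lemma coatom_in_zero_divisors: "coatom i \<in> zero_divisors"
  by (auto simp: zero_divisors_boolean_vec coatom_def vec_eq_iff)

lemma inj_coatom: "inj coatom"
  by (rule injI) (auto simp: coatom_def vec_eq_iff split: if_splits)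

lemma graph_dist_coatom:
  assumes "x \<in> zero_divisors"
  shows "graph_dist (with_proj Gamma1) x (coatom i) =
    (if x = coatom i then 0 else if x $ i = 0 then 1 else 2)"
proof -
  have "x + coatom i = 1 \<longleftrightarrow> x $ i = 1"
    by (auto simp: vec_eq_iff coatom_def boolean_add_eq_1_iff)
  then have "x + coatom i \<in> zero_divisors \<longleftrightarrow> x $ i = 0"
    using boolean_neq_0_iff by (auto simp: zero_divisors_boolean_vec)
  then show ?thesis
    using assms by (simp add: graph_dist_Gamma1 coatom_in_zero_divisors)
qed

text \<open>
  The coatom itself, at distance \<open>0\<close>, has entry \<open>0\<close> at \<open>i\<close> as well, so the three possible
  distances never confuse the two possible entries.
\<close>

lemma nth_eq_if_graph_dist_coatom_eq:
  assumes "x \<in> zero_divisors" "y \<in> zero_divisors"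
    and "graph_dist (with_proj Gamma1) x (coatom i) = graph_dist (with_proj Gamma1) y (coatom i)"
  shows "x $ i = y $ i" and "x = coatom i \<longleftrightarrow> y = coatom i"
proof -
  have "coatom i $ i = 0"
    by (simp add: coatom_def)
  with assms show "x $ i = y $ i" "x = coatom i \<longleftrightarrow> y = coatom i"
    using boolean_neq_0_iff by (auto simp: graph_dist_coatom split: if_splits)
qed

lemma resolving_set_coatoms:
  assumes "distinct is" "set is = (UNIV :: 'n::finite set)"
  shows "resolving_set (with_proj Gamma1) (map (coatom :: 'n \<Rightarrow> _) is)"
proof -
  have "x = y"
    if "x \<in> zero_divisors" "y \<in> zero_divisors"
      "representation (with_proj Gamma1) (map coatom is) x =
       representation (with_proj Gamma1) (map coatom is) y"
    for x y :: "boolean ^ 'n"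
  proof -
    have "graph_dist (with_proj Gamma1) x (coatom i) = graph_dist (with_proj Gamma1) y (coatom i)" for i
      using that(3) assms(2) by (simp add: representation_def)
    then show ?thesis
      using nth_eq_if_graph_dist_coatom_eq(1)[OF that(1,2)] by (simp add: vec_eq_iff)
  qed
  then show ?thesis
    using assms(1) inj_on_subset[OF inj_coatom]
    by (auto simp: resolving_set_def distinct_map coatom_in_zero_divisors)
qed

text \<open>
  Two distinct vertices that agree at \<open>i\<close> must differ at \<open>j\<close>, so one of them is \<open>1\<close> there.  It
  cannot be \<open>1\<close> at \<open>i\<close> too, hence it is the landmark, and the other one is not.
\<close>

lemma resolving_set_singleton_coatom:
  fixes i j :: "'n::finite"
  assumes ij: "(UNIV :: 'n set) = {i, j}" "i \<noteq> j"
  shows "resolving_set (with_proj Gamma1) [coatom i]"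
proof -
  have vec_eq: "x = y \<longleftrightarrow> x $ i = y $ i \<and> x $ j = y $ j" for x y :: "boolean ^ 'n"
    using ij(1) by (metis UNIV_I insertE singletonD vec_eq_iff)
  have coatom: "coatom i $ i = 0" "coatom i $ j = 1"
    using ij(2) by (auto simp: coatom_def)
  have "x = y"
    if x: "x \<in> zero_divisors" and y: "y \<in> zero_divisors"
      and d: "graph_dist (with_proj Gamma1) x (coatom i) = graph_dist (with_proj Gamma1) y (coatom i)"
    for x y :: "boolean ^ 'n"
  proof -
    note same = nth_eq_if_graph_dist_coatom_eq[OF x y d]
    have "x \<noteq> 1" "y \<noteq> 1"
      using x y by (auto simp: zero_divisors_boolean_vec)
    then show ?thesis
      using same coatom boolean_neq_0_iff unfolding vec_eq one_index by metis
  qed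
  then show ?thesis
    by (auto simp: resolving_set_def representation_def coatom_in_zero_divisors)
qed

lemma length_resolving_set_boolean_vec:
  fixes ws :: "(boolean ^ 'n::finite) list"
  assumes "resolving_set (with_proj Gamma1) ws"
  shows "2 ^ CARD('n) \<le> length ws + 2 ^ length ws + 1"
proof -
  have "card (zero_divisors :: (boolean ^ 'n) set) \<le> length ws + 2 ^ length ws"
    using card_verts_le_if_resolving[OF assms] by (simp add: graph_dist_Gamma1)
  then show ?thesis
    by (simp add: card_zero_divisors_boolean_vec)
qed

section \<open>The metric dimension\<close>

lemma Suc_less_two_power: "2 \<le> m \<Longrightarrow> Suc m < 2 ^ m"
  by (induction m rule: dec_induct) auto

theorem proposition3p2:
  assumes "CARD('n::finite) \<ge> 2"
  shows "(CARD('n) \<noteq> 2 \<longrightarrow>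
            metric_dim (with_proj (Gamma1 :: (boolean ^ 'n) pair_pre_digraph)) = CARD('n))
       \<and> (CARD('n) = 2 \<longrightarrow>
            metric_dim (with_proj (Gamma1 :: (boolean ^ 'n) pair_pre_digraph)) = CARD('n) - 1)"
proof (intro conjI impI)
  let ?G = "with_proj (Gamma1 :: (boolean ^ 'n) pair_pre_digraph)"
  {
    assume "CARD('n) \<noteq> 2"
    with assms obtain m where m: "CARD('n) = Suc m" "2 \<le> m"
      by (cases "CARD('n)") auto
    obtain "is" where "is": "set is = (UNIV :: 'n set)" "distinct is"
      using finite_distinct_list[of "UNIV :: 'n set"] by auto
    show "metric_dim ?G = CARD('n)"
    proof (rule metric_dim_eqI)
      show "resolving_set ?G (map coatom is)"
        using "is" by (simp add: resolving_set_coatoms)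
      show "length (map coatom is) = CARD('n)"
        using "is" by (metis distinct_card length_map)
    next
      fix ws :: "(boolean ^ 'n) list"
      assume ws: "resolving_set ?G ws"
      show "CARD('n) \<le> length ws"
      proof (rule ccontr)
        assume "\<not> ?thesis"
        then have le: "length ws \<le> m"
          using m by simp
        have "2 ^ Suc m \<le> length ws + 2 ^ length ws + 1"
          using length_resolving_set_boolean_vec[OF ws] m by simp
        also have "\<dots> \<le> m + 2 ^ m + 1"
          using le by (intro add_mono power_increasing) auto
        finally show False
          using Suc_less_two_power[OF m(2)] by simp
      qed
    qed
  }
  {
    assume card: "CARD('n) = 2"
    then obtain i j where ij: "(UNIV :: 'n set) = {i, j}" "i \<noteq> j"
      by (auto simp: card_2_iff)
    show "metric_dim ?G = CARD('n) - 1"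
    proof (rule metric_dim_eqI)
      show "resolving_set ?G [coatom i]"
        using ij by (rule resolving_set_singleton_coatom)
      show "length [coatom i] = CARD('n) - 1"
        using card by simp
    next
      fix ws :: "(boolean ^ 'n) list"
      assume "resolving_set ?G ws"
      from length_resolving_set_boolean_vec[OF this] show "CARD('n) - 1 \<le> length ws"
        using card by (cases ws) auto
    qed
  }
qed

end
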